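(* For every $n\ge 1$, the multivariate avalanche polynomial of the cycle graph $C_{n+1}$ is $$\mathscr{A}_{C_{n+1}}(x_1,\dots,x_n)=\sum_{i=1}^n \mu_{C_{n+1}}(1^{n}, v_i) + \sum_{p=2}^{n} \sum_{i=1}^{p-1} \mu_{C_{p}}(1^{p-1}, v_i) + \sum_{p=1}^{n-1} \sum_{i=p+1}^{n} \mu_{C_{n-p+1}^{p}}(1^{n-p}, v_{i}) + n,$$ where $\displaystyle \mu_{C_{q+1}}(1^{q}, v_i) = \prod_{j=1}^m x_jx_{j+1}\cdots x_{q-j+1}$ for $1\le i\le q$, with $m=\min\{i,q-i+1\}$.
   Context: A graph $G=(V,E,s)$ is a finite connected undirected multigraph without loops, with a distinguished vertex $s$ called the sink; $\widetilde V = V\setminus\{s\}$. $d_v$ is the degree of $v$ (counted with multiplicity, including edges to $s$) and $\mathrm{wt}(u,v)$ is the number of edges between $u$ and $v$. A sandpile is a function $c:\widetilde V\to\mathbb{Z}_{\ge 0}$. A vertex $v\in\widetilde V$ is unstable if $c(v)\ge d_v$; an unstable vertex may topple, which replaces $c$ by $c'$ with $c'(v)=c(v)-d_v$ and $c'(w)=c(w)+\mathrm{wt}(v,w)$ for $w\in\widetilde V$, $w\ne v$. A sandpile is stable if it has no unstable vertex. Any sequence of topplings of unstable vertices starting at $c$ that ends in a stable sandpile ends in the same stable sandpile $c^\circ$ (the stabilization), with the same number of topplings of each vertex; the vector of these numbers is the toppling vector of the stabilization. Put $a\oplus b=(a+b)^\circ$. A stable sandpile $c$ is recurrent if for every sandpile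 $a$ there is a sandpile $b$ with $a\oplus b=c$; the set of recurrent sandpiles is $\mathscr{S}(G)$. For $v\in\widetilde V$, $1_v$ is the sandpile with one grain at $v$ and none elsewhere. Each non-sink vertex $v_i$ has an associated variable $x_i$. For $c$ recurrent, the avalanche monomial is $\mu_G(c,v_k)=\prod_{i} x_i^{f_i}$, where $f_i$ is the entry at $v_i$ of the toppling vector of the stabilization of $c+1_{v_k}$. The multivariate avalanche polynomial is $\mathscr{A}_G=\sum_{c\in\mathscr{S}(G)}\sum_{v\in\widetilde V}\mu_G(c,v)$. $C_{n+1}$ is the cycle on $n+1$ vertices labeled $s,v_1,\dots,v_n$ in cyclic order, with sink $s$; $C_2$ denotes the graph with two vertices $s,v_1$ and two edges between them. For an integer $q$, $C_{n+1}^{q}$ is the same cycle with its vertices labeled $s,v_{q+1},\dots,v_{q+n}$ in cyclic order (so its variables are $x_{q+1},\dots,x_{q+n}$). $1^n$ denotes the sandpile with one grain of sand at each of the $n$ non-sink vertices; it is recurrent. *)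

theory Defs
  imports "HOL-Library.Multiset" "HOL-Library.Poly_Mapping"
begin

section \<open>Graphs with a sink\<close>

text \<open>An edge is the set of its two endpoints; parallel edges are repeated elements of the
  multiset of edges.\<close>

record 'v sink_graph =
  verts :: "'v set"
  edges :: "'v set multiset"
  sink :: 'v

definition sandpile_graph :: "'v sink_graph \<Rightarrow> bool" where
  "sandpile_graph G \<longleftrightarrow>
     finite (verts G) \<and> sink G \<in> verts G \<and>
     (\<forall>e. e \<in># edges G \<longrightarrow> e \<subseteq> verts G \<and> card e = 2) \<and>
     (\<forall>u\<in>verts G. \<forall>v\<in>verts G. (u, v) \<in> {(a, b). {a, b} \<in># edges G}\<^sup>*)"

definition nonsink :: "'v sink_graph \<Rightarrow> 'v set" where
  "nonsink G = verts G - {sink G}"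

definition wt :: "'v sink_graph \<Rightarrow> 'v \<Rightarrow> 'v \<Rightarrow> nat" where
  "wt G u v = count (edges G) {u, v}"

definition deg :: "'v sink_graph \<Rightarrow> 'v \<Rightarrow> nat" where
  "deg G v = size {#e \<in># edges G. v \<in> e#}"


section \<open>Sandpiles\<close>

text \<open>Sandpiles are extended by \<open>0\<close> outside the non-sink vertices, so that equality of
  functions is equality of sandpiles.\<close>

definition sandpiles :: "'v sink_graph \<Rightarrow> ('v \<Rightarrow> nat) set" where
  "sandpiles G = {c. \<forall>v. v \<notin> nonsink G \<longrightarrow> c v = 0}"

definition unstable :: "'v sink_graph \<Rightarrow> ('v \<Rightarrow> nat) \<Rightarrow> 'v \<Rightarrow> bool" where
  "unstable G c v \<longleftrightarrow> v \<in> nonsink G \<and> deg G v \<le> c v"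

definition stable :: "'v sink_graph \<Rightarrow> ('v \<Rightarrow> nat) \<Rightarrow> bool" where
  "stable G c \<longleftrightarrow> (\<forall>v. \<not> unstable G c v)"

definition topple :: "'v sink_graph \<Rightarrow> 'v \<Rightarrow> ('v \<Rightarrow> nat) \<Rightarrow> 'v \<Rightarrow> nat" where
  "topple G v c =
     (\<lambda>w. if w = v then c v - deg G v
          else if w \<in> nonsink G then c w + wt G v w
          else c w)"

inductive toppling_seq ::
  "'v sink_graph \<Rightarrow> ('v \<Rightarrow> nat) \<Rightarrow> 'v list \<Rightarrow> ('v \<Rightarrow> nat) \<Rightarrow> bool" for G where
  toppling_seq_Nil: "toppling_seq G c [] c"
| toppling_seq_Cons: "unstable G c v \<Longrightarrow> toppling_seq G (topple G v c) vs c' \<Longrightarrow>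
    toppling_seq G c (v # vs) c'"

text \<open>On a \<^const>\<open>sandpile_graph\<close> both descriptions below are satisfied by exactly one object,
  since stabilization is independent of the order of topplings.\<close>

definition stabilization :: "'v sink_graph \<Rightarrow> ('v \<Rightarrow> nat) \<Rightarrow> 'v \<Rightarrow> nat" where
  "stabilization G c = (THE c'. \<exists>vs. toppling_seq G c vs c' \<and> stable G c')"

definition toppling_vector :: "'v sink_graph \<Rightarrow> ('v \<Rightarrow> nat) \<Rightarrow> 'v \<Rightarrow> nat" where
  "toppling_vector G c =
     (THE f. \<exists>vs c'. toppling_seq G c vs c' \<and> stable G c' \<and> f = count_list vs)"

definition stable_sum :: "'v sink_graph \<Rightarrow> ('v \<Rightarrow> nat) \<Rightarrow> ('v \<Rightarrow> nat) \<Rightarrow> 'v \<Rightarrow> nat" where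
  "stable_sum G a b = stabilization G (\<lambda>v. a v + b v)"

definition recurrents :: "'v sink_graph \<Rightarrow> ('v \<Rightarrow> nat) set" where
  "recurrents G = {c \<in> sandpiles G. stable G c \<and>
     (\<forall>a\<in>sandpiles G. \<exists>b\<in>sandpiles G. stable_sum G a b = c)}"

definition grain :: "'v \<Rightarrow> 'v \<Rightarrow> nat" where
  "grain v = (\<lambda>w. if w = v then 1 else 0)"

definition all_ones :: "'v sink_graph \<Rightarrow> 'v \<Rightarrow> nat" where
  "all_ones G = (\<lambda>v. if v \<in> nonsink G then 1 else 0)"

text \<open>The sum over \<^const>\<open>recurrents\<close> in the avalanche polynomial is a finite one.\<close>

lemma finite_recurrents:
  assumes "sandpile_graph G"
  shows "finite (recurrents G)"
proof -
  have fin: "finite (nonsink G)"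
    using assms by (simp add: sandpile_graph_def nonsink_def)
  let ?M = "\<Sum>v\<in>nonsink G. deg G v"
  have "recurrents G \<subseteq> {c. \<forall>v. (v \<in> nonsink G \<longrightarrow> c v \<in> {..?M}) \<and> (v \<notin> nonsink G \<longrightarrow> c v = 0)}"
  proof (intro subsetI CollectI allI conjI impI)
    fix c v assume c: "c \<in> recurrents G" and v: "v \<in> nonsink G"
    have "c v < deg G v"
      using c v by (force simp: recurrents_def stable_def unstable_def)
    also have "\<dots> \<le> ?M"
      using fin v by (simp add: member_le_sum)
    finally show "c v \<in> {..?M}" by simp
  next
    fix c v assume "c \<in> recurrents G" "v \<notin> nonsink G"
    then show "c v = 0" by (simp add: recurrents_def sandpiles_def)
  qed
  then show ?thesis
    using finite_set_of_finite_funs[OF fin finite_atMost] by (rule finite_subset)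
qed


section \<open>Avalanche polynomials\<close>

text \<open>Integer polynomials with one variable for each vertex.\<close>

type_synonym 'v polynomial = "('v \<Rightarrow>\<^sub>0 nat) \<Rightarrow>\<^sub>0 int"

definition Var :: "'v \<Rightarrow> 'v polynomial" where
  "Var v = Poly_Mapping.single (Poly_Mapping.single v 1) 1"

definition avalanche_monomial ::
  "'v sink_graph \<Rightarrow> ('v \<Rightarrow> nat) \<Rightarrow> 'v \<Rightarrow> 'v polynomial" where
  "avalanche_monomial G c v =
     (\<Prod>u\<in>nonsink G. Var u ^ toppling_vector G (\<lambda>w. c w + grain v w) u)"

definition avalanche_polynomial :: "'v sink_graph \<Rightarrow> 'v polynomial" where
  "avalanche_polynomial G =
     (\<Sum>c\<in>recurrents G. \<Sum>v\<in>nonsink G. avalanche_monomial G c v)"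


section \<open>Cycle graphs\<close>

datatype cycle_vertex = Sink | Vtx int

fun cycle_label :: "int \<Rightarrow> nat \<Rightarrow> cycle_vertex" where
  "cycle_label q 0 = Sink"
| "cycle_label q (Suc k) = Vtx (q + int (Suc k))"

text \<open>\<open>cycle_graph N q\<close> is the cycle on \<open>N \<ge> 2\<close> vertices, the sink included, whose other vertices
  are labelled \<open>q + 1, \<dots>, q + N - 1\<close> in cyclic order. For \<open>N = 2\<close> the multiset of edges contains
  the edge \<open>{Sink, Vtx (q + 1)}\<close> twice.\<close>

definition cycle_graph :: "nat \<Rightarrow> int \<Rightarrow> cycle_vertex sink_graph" where
  "cycle_graph N q =
     \<lparr>verts = cycle_label q ` {..<N},
      edges = {#{cycle_label q k, cycle_label q (Suc k mod N)}. k \<in># mset_set {..<N}#},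
      sink = Sink\<rparr>"

lemma inj_cycle_label: "inj (cycle_label q)"
proof (rule injI)
  fix a b assume "cycle_label q a = cycle_label q b"
  then show "a = b" by (cases a; cases b) auto
qed

lemma sandpile_graph_cycle_graph:
  assumes "2 \<le> N"
  shows "sandpile_graph (cycle_graph N q)"
proof -
  let ?R = "{(a, b). {a, b} \<in># edges (cycle_graph N q)}"
  have sym: "sym (?R\<^sup>*)"
    by (rule sym_rtrancl) (auto simp: sym_def insert_commute)
  have reach: "(Sink, cycle_label q k) \<in> ?R\<^sup>*" if "k < N" for k
    using that
  proof (induction k)
    case (Suc k)
    have "(cycle_label q k, cycle_label q (Suc k)) \<in> ?R"
      using Suc.prems by (auto simp: cycle_graph_def intro!: image_eqI[where x = k])
    with Suc show ?case by (meson Suc_lessD rtrancl.rtrancl_into_rtrancl)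
  qed simp
  have "card {cycle_label q k, cycle_label q (Suc k mod N)} = 2" if "k < N" for k
  proof -
    have "k \<noteq> Suc k mod N" using assms that by (cases "Suc k = N") auto
    then show ?thesis using inj_cycle_label[of q] by (simp add: inj_eq)
  qed
  moreover have "(u, v) \<in> ?R\<^sup>*" if "u \<in> verts (cycle_graph N q)" "v \<in> verts (cycle_graph N q)" for u v
  proof -
    have "(Sink, u) \<in> ?R\<^sup>*" "(Sink, v) \<in> ?R\<^sup>*"
      using that reach by (auto simp: cycle_graph_def)
    then show ?thesis using symD[OF sym] by (blast intro: rtrancl_trans)
  qed
  moreover have "Sink \<in> cycle_label q ` {..<N}"
    using assms by (intro image_eqI[where x = 0]) auto
  ultimately show ?thesis
    using assms unfolding sandpile_graph_def by (auto simp: cycle_graph_def)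
qed

lemma nonsink_cycle_graph: "nonsink (cycle_graph (Suc n) q) = Vtx ` {q + 1..q + int n}"
proof -
  have "cycle_label q ` {..<Suc n} - {Sink} = (\<lambda>k. Vtx (q + int (Suc k))) ` {..<n}"
    by (auto simp: lessThan_Suc_eq_insert_0 image_iff)
  also have "\<dots> = Vtx ` {q + 1..q + int n}"
  proof (intro equalityI subsetI)
    fix v assume "v \<in> Vtx ` {q + 1..q + int n}"
    then obtain i where "v = Vtx i" "q + 1 \<le> i" "i \<le> q + int n" by auto
    then show "v \<in> (\<lambda>k. Vtx (q + int (Suc k))) ` {..<n}"
      by (intro image_eqI[where x = "nat (i - q - 1)"]) auto
  qed auto
  finally show ?thesis by (simp add: nonsink_def cycle_graph_def)
qed

end

theory Submission
  imports Defs
begin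

text \<open>A legal toppling sequence never exceeds a nonnegative vector that leaves a stable
  configuration (least action principle), so the toppling vector is the least such vector. On an
  interval of ones between two empty vertices \<open>a < b\<close> (or the sink), a grain added at \<open>i\<close> yields
  the vector \<open>min (i - a) (b - i) (k - a) (b - k)\<close>; its minimality is a discrete maximum
  principle, because any smaller vector would differ from it by a function that is convex up to a
  kink of height one. On the cycle a stable sandpile with two empty vertices contains a forbidden
  subconfiguration, so the recurrent sandpiles are \<open>1\<^sup>n\<close> and the \<open>1\<^sup>n - 1\<^sub>p\<close>; an empty vertex \<open>p\<close>
  splits the cycle into two smaller ones.\<close>

section \<open>The least action principle\<close>

text \<open>The reduced Laplacian: the sum skips the sink, so grains sent there are lost. Values are
  integers because a vertex may gain more grains than it loses.\<close>

definition laplacian :: "'v sink_graph \<Rightarrow> ('v \<Rightarrow> nat) \<Rightarrow> 'v \<Rightarrow> int" where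
  "laplacian G f v = int (deg G v * f v) - (\<Sum>u\<in>nonsink G. int (wt G u v * f u))"

text \<open>Firing \<open>f\<close> all at once, whether or not the topplings are legal, leaves
  every non-sink vertex below its degree; entries may become negative.\<close>

definition bounds_topplings :: "'v sink_graph \<Rightarrow> ('v \<Rightarrow> nat) \<Rightarrow> ('v \<Rightarrow> nat) \<Rightarrow> bool" where
  "bounds_topplings G c f \<longleftrightarrow> (\<forall>v\<in>nonsink G. int (c v) - laplacian G f v < int (deg G v))"

section \<open>Toppling sequences in terms of the Laplacian\<close>

lemma finite_nonsink: "sandpile_graph G \<Longrightarrow> finite (nonsink G)"
  by (simp add: sandpile_graph_def nonsink_def)

lemma wt_self: "sandpile_graph G \<Longrightarrow> wt G v v = 0"
  by (fastforce simp: sandpile_graph_def wt_def count_eq_zero_iff)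

lemma laplacian_add: "laplacian G (\<lambda>v. f v + g v) v = laplacian G f v + laplacian G g v"
  by (simp add: laplacian_def algebra_simps sum.distrib)

lemma laplacian_grain:
  assumes "finite (nonsink G)" "u \<in> nonsink G"
  shows "laplacian G (grain u) v = (if v = u then int (deg G u) else 0) - int (wt G u v)"
proof -
  have "(\<Sum>w\<in>nonsink G. int (wt G w v * grain u w))
      = (\<Sum>w\<in>nonsink G. if w = u then int (wt G u v) else 0)"
    by (rule sum.cong) (auto simp: grain_def)
  then show ?thesis
    using assms by (auto simp: laplacian_def grain_def)
qed

lemma topple_eq_laplacian:
  assumes "sandpile_graph G" "unstable G c u" "v \<in> nonsink G"
  shows "int (topple G u c v) = int (c v) - laplacian G (grain u) v"
  using assms finite_nonsink[OF assms(1)] wt_self[OF assms(1)]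
  by (auto simp: laplacian_grain topple_def unstable_def)

lemma count_list_Cons_grain: "count_list (u # vs) = (\<lambda>v. grain u v + count_list vs v)"
  by (auto simp: grain_def fun_eq_iff)

lemma toppling_seq_eq_laplacian:
  assumes "sandpile_graph G" "toppling_seq G c vs c'" "v \<in> nonsink G"
  shows "int (c' v) = int (c v) - laplacian G (count_list vs) v"
  using assms(2)
proof induction
  case (toppling_seq_Nil c)
  then show ?case by (simp add: laplacian_def)
next
  case (toppling_seq_Cons c u vs c')
  then show ?case
    using topple_eq_laplacian[OF assms(1) _ assms(3)]
    unfolding count_list_Cons_grain laplacian_add by simp
qed

lemma toppling_seq_outside:
  assumes "toppling_seq G c vs c'" "v \<notin> nonsink G"
  shows "c' v = c v"
  using assms by induction (auto simp: topple_def unstable_def)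

lemma toppling_seq_subset_nonsink: "toppling_seq G c vs c' \<Longrightarrow> set vs \<subseteq> nonsink G"
  by (induction rule: toppling_seq.induct) (auto simp: unstable_def)

lemma toppling_seq_append:
  "toppling_seq G a vs b \<Longrightarrow> toppling_seq G b ws c \<Longrightarrow> toppling_seq G a (vs @ ws) c"
  by (induction rule: toppling_seq.induct) (auto intro: toppling_seq.intros)

lemma toppling_seq_add:
  "toppling_seq G a vs c \<Longrightarrow> toppling_seq G (\<lambda>v. a v + b v) vs (\<lambda>v. c v + b v)"
proof (induction rule: toppling_seq.induct)
  case (toppling_seq_Cons c v vs c')
  have "topple G v (\<lambda>v. c v + b v) = (\<lambda>w. topple G v c w + b w)"
    using toppling_seq_Cons by (auto simp: topple_def unstable_def)
  with toppling_seq_Cons show ?case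
    by (auto intro!: toppling_seq.intros simp: unstable_def)
qed (rule toppling_seq.intros)

text \<open>At an unstable \<open>u\<close> the Laplacian of \<open>f\<close> must be positive,
  which forces \<open>0 < f u\<close> because its off-diagonal entries are nonpositive. By
  linearity, spending one unit of \<open>f\<close> on toppling \<open>u\<close> leaves the final
  configuration unchanged.\<close>

lemma bounds_topplings_topple:
  assumes G: "sandpile_graph G" and f: "bounds_topplings G c f" and u: "unstable G c u"
  shows "0 < f u" "bounds_topplings G (topple G u c) (f(u := f u - 1))"
proof -
  have "int (c u) - laplacian G f u < int (deg G u)" "int (deg G u) \<le> int (c u)"
    using f u by (auto simp: bounds_topplings_def unstable_def)
  then have "0 < laplacian G f u" by linarith
  then show pos: "0 < f u"
    by (rule contrapos_pp) (simp add: laplacian_def sum_nonneg not_less)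
  then have "f = (\<lambda>v. grain u v + (f(u := f u - 1)) v)"
    by (auto simp: grain_def)
  then have split:
    "laplacian G f v = laplacian G (grain u) v + laplacian G (f(u := f u - 1)) v" for v
    by (metis laplacian_add)
  show "bounds_topplings G (topple G u c) (f(u := f u - 1))"
    unfolding bounds_topplings_def
  proof
    fix v assume "v \<in> nonsink G"
    with f topple_eq_laplacian[OF G u] split[of v]
    show "int (topple G u c v) - laplacian G (f(u := f u - 1)) v < int (deg G v)"
      by (auto simp: bounds_topplings_def)
  qed
qed

text \<open>Least action: each legal toppling spends one unit of \<open>f\<close> at its vertex, and
  the reduced \<open>f\<close> still bounds what follows.\<close>

lemma count_list_le_bound:
  assumes "sandpile_graph G" "toppling_seq G c vs c'" "bounds_topplings G c f"
  shows "count_list vs v \<le> f v"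
  using assms(2,3)
proof (induction arbitrary: f)
  case (toppling_seq_Cons c u vs c')
  note f' = bounds_topplings_topple[OF assms(1) toppling_seq_Cons.prems toppling_seq_Cons.hyps(1)]
  show ?case
    using toppling_seq_Cons.IH[OF f'(2)] f'(1) by (auto split: if_splits)
qed simp

section \<open>Uniqueness and existence of stabilizations\<close>

lemma bounds_topplings_count_list:
  assumes "sandpile_graph G" "toppling_seq G c vs c'" "stable G c'"
  shows "bounds_topplings G c (count_list vs)"
  using assms toppling_seq_eq_laplacian[OF assms(1,2)]
  by (force simp: bounds_topplings_def stable_def unstable_def)

text \<open>Both count vectors are bounds themselves, so the least action principle gives both
  inequalities.\<close>

lemma toppling_counts_unique:
  assumes "sandpile_graph G"
    "toppling_seq G c vs c'" "stable G c'" "toppling_seq G c ws d'" "stable G d'"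
  shows "count_list vs = count_list ws"
  using assms by (meson antisym bounds_topplings_count_list count_list_le_bound ext)

lemma toppling_vector_eqI:
  assumes "sandpile_graph G" "toppling_seq G c vs c'" "stable G c'"
  shows "toppling_vector G c = count_list vs"
  unfolding toppling_vector_def
  using assms by (intro the_equality) (auto dest: toppling_counts_unique)

text \<open>Equal counts force equal results at non-sink vertices, where the result is
  \<open>c\<close> minus the Laplacian of the counts; elsewhere topplings change nothing.\<close>

lemma stabilization_eqI:
  assumes G: "sandpile_graph G" and vs: "toppling_seq G c vs c'" "stable G c'"
  shows "stabilization G c = c'"
  unfolding stabilization_def
proof (rule the_equality)
  fix d assume "\<exists>ws. toppling_seq G c ws d \<and> stable G d"
  then obtain ws where ws: "toppling_seq G c ws d" "stable G d" by blast
  show "d = c'"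
  proof
    fix v
    show "d v = c' v"
    proof (cases "v \<in> nonsink G")
      case True
      then have "int (d v) = int (c' v)"
        using toppling_counts_unique[OF G vs ws] toppling_seq_eq_laplacian[OF G vs(1)]
          toppling_seq_eq_laplacian[OF G ws(1)] by simp
      then show ?thesis by simp
    qed (simp add: toppling_seq_outside[OF vs(1)] toppling_seq_outside[OF ws(1)])
  qed
qed (use vs in blast)

text \<open>A bound certifies termination: its total drops with every legal toppling.\<close>

lemma bounds_topplings_imp_stabilizes:
  assumes "sandpile_graph G" "bounds_topplings G c f"
  obtains vs c' where "toppling_seq G c vs c'" "stable G c'"
proof -
  have "\<exists>vs c'. toppling_seq G c vs c' \<and> stable G c'"
    using assms(2)
  proof (induction "\<Sum>v\<in>nonsink G. f v" arbitrary: c f rule: less_induct)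
    case less
    show ?case
    proof (cases "stable G c")
      case True
      then show ?thesis by (blast intro: toppling_seq.intros)
    next
      case False
      then obtain u where u: "unstable G c u" by (auto simp: stable_def)
      note f' = bounds_topplings_topple[OF assms(1) less.prems u]
      have "(\<Sum>v\<in>nonsink G. (f(u := f u - 1)) v) < (\<Sum>v\<in>nonsink G. f v)"
        using f'(1) u finite_nonsink[OF assms(1)]
        by (intro sum_strict_mono_ex1) (auto simp: unstable_def)
      from less.hyps[OF this f'(2)] u show ?thesis by (blast intro: toppling_seq.intros)
    qed
  qed
  then show thesis using that by blast
qed

text \<open>Burning argument: look at the vertex of \<open>F\<close> whose last toppling comes first; each of its
  neighbours in \<open>F\<close> sends it a grain afterwards.\<close>

lemma not_forbidden_subconfiguration:
  assumes G: "sandpile_graph G" and vs: "toppling_seq G c vs c'"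
    and F: "F \<noteq> {}" "F \<subseteq> set vs"
  shows "\<exists>v\<in>F. (\<Sum>u\<in>F. wt G u v) \<le> c' v"
  using vs F(2)
proof induction
  case (toppling_seq_Cons c v vs c')
  show ?case
  proof (cases "F \<subseteq> set vs")
    case False
    then have v: "v \<in> F" "v \<notin> set vs" and F': "F - {v} \<subseteq> set vs"
      using toppling_seq_Cons.prems by auto
    have vG: "v \<in> nonsink G" using toppling_seq_Cons.hyps by (simp add: unstable_def)
    have vsG: "set vs \<subseteq> nonsink G"
      using toppling_seq_Cons.hyps by (simp add: toppling_seq_subset_nonsink)
    have fin: "finite F" using toppling_seq_Cons.prems finite_subset by auto
    have "(\<Sum>u\<in>F. wt G u v) = (\<Sum>u\<in>F - {v}. wt G u v)"
      using fin v wt_self[OF G] by (simp add: sum.remove)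
    also have "\<dots> \<le> (\<Sum>u\<in>F - {v}. wt G u v * count_list vs u)"
    proof (rule sum_mono)
      fix u assume "u \<in> F - {v}"
      then have "count_list vs u \<noteq> 0" using F' by (auto simp: count_list_0_iff)
      then show "wt G u v \<le> wt G u v * count_list vs u" by simp
    qed
    also have "\<dots> \<le> (\<Sum>u\<in>nonsink G. wt G u v * count_list vs u)"
      using F' vsG finite_nonsink[OF G] by (intro sum_mono2) auto
    \<comment> \<open>\<open>v\<close> does not occur in \<open>vs\<close>, so the diagonal term
      vanishes and minus the Laplacian counts the grains that \<open>v\<close> receives after its
      last toppling.\<close>
    finally have "int (\<Sum>u\<in>F. wt G u v) \<le> - laplacian G (count_list vs) v"
      using v by (simp add: laplacian_def count_notin flip: of_nat_mult of_nat_sum)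
    also have "\<dots> \<le> int (c' v)"
      using toppling_seq_eq_laplacian[OF G toppling_seq_Cons.hyps(2) vG] by simp
    finally have "(\<Sum>u\<in>F. wt G u v) \<le> c' v" by (simp only: of_nat_le_iff)
    then show ?thesis using v by blast
  qed (use toppling_seq_Cons.IH in blast)
qed (use F(1) in auto)

text \<open>Only its own toppling takes grains from a vertex, so it stays unstable until it
  topples.\<close>

lemma unstable_imp_toppled:
  assumes "toppling_seq G c vs c'" "stable G c'" "unstable G c v"
  shows "v \<in> set vs"
  using assms
proof induction
  case (toppling_seq_Cons c u vs c')
  then show ?case by (cases "v = u") (auto simp: unstable_def topple_def)
qed (auto simp: stable_def)

text \<open>Reaching \<open>c\<close> from a sandpile that is unstable at every non-sink vertex
  makes all of \<open>F\<close> topple. Existence of stabilizing sequences is assumed here and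
  supplied for cycles by \<open>cycle_stabilizes\<close>.\<close>

lemma recurrent_burning:
  assumes G: "sandpile_graph G" and c: "c \<in> recurrents G"
    and stabilizes: "\<And>a. \<exists>vs a'. toppling_seq G a vs a' \<and> stable G a'"
    and F: "F \<noteq> {}" "F \<subseteq> nonsink G"
  shows "\<exists>v\<in>F. (\<Sum>u\<in>F. wt G u v) \<le> c v"
proof -
  define a where "a = (\<lambda>v. if v \<in> nonsink G then deg G v else 0)"
  have "a \<in> sandpiles G" by (simp add: a_def sandpiles_def)
  then obtain b where b: "stabilization G (\<lambda>v. a v + b v) = c"
    using c by (auto simp: recurrents_def stable_sum_def)
  obtain vs c' where vs: "toppling_seq G (\<lambda>v. a v + b v) vs c'" "stable G c'"
    using stabilizes by blast
  have "F \<subseteq> set vs"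
    using F unstable_imp_toppled[OF vs] by (auto simp: unstable_def a_def)
  with not_forbidden_subconfiguration[OF G vs(1) F(1)] stabilization_eqI[OF G vs] b
  show ?thesis by auto
qed


section \<open>The cycle\<close>

lemma cycle_label_edge_eq_iff:
  "{cycle_label q a, cycle_label q b} = {cycle_label q c, cycle_label q d} \<longleftrightarrow> {a, b} = {c, d}"
  using inj_cycle_label[of q] by (auto simp: doubleton_eq_iff inj_eq)

text \<open>Edge \<open>i\<close> joins positions \<open>i\<close> and \<open>i + 1\<close> modulo
  \<open>Suc n\<close>. Counting indices rather than edge sets keeps the double edge for
  \<open>n = 1\<close> correct.\<close>

lemma deg_cycle_label:
  assumes "1 \<le> k" "k \<le> n"
  shows "deg (cycle_graph (Suc n) q) (cycle_label q k) = 2"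
proof -
  have "deg (cycle_graph (Suc n) q) (cycle_label q k)
      = card {i \<in> {..<Suc n}. k \<in> {i, Suc i mod Suc n}}"
    using inj_cycle_label[of q]
    by (simp add: deg_def cycle_graph_def filter_mset_image_mset inj_eq del: mod_Suc)
  also have "{i \<in> {..<Suc n}. k \<in> {i, Suc i mod Suc n}} = {k - 1, k}"
    using assms by (auto simp: mod_Suc)
  finally show ?thesis using assms by simp
qed

lemma wt_cycle_label:
  assumes "1 \<le> j" "j \<le> n" "1 \<le> k" "k \<le> n"
  shows "wt (cycle_graph (Suc n) q) (cycle_label q j) (cycle_label q k)
    = of_bool (j = Suc k \<or> k = Suc j)"
proof -
  have "wt (cycle_graph (Suc n) q) (cycle_label q j) (cycle_label q k)
      = card {i \<in> {..<Suc n}. {i, Suc i mod Suc n} = {j, k}}"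
    by (simp add: wt_def cycle_graph_def count_image_mset' cycle_label_edge_eq_iff eq_commute)
  also have "{i \<in> {..<Suc n}. {i, Suc i mod Suc n} = {j, k}}
      = (if j = Suc k then {k} else if k = Suc j then {j} else {})"
    using assms by (auto simp: doubleton_eq_iff mod_Suc)
  finally show ?thesis by auto
qed

section \<open>Degrees, weights and the Laplacian in integer labels\<close>

lemma cycle_label_nat:
  assumes "q < k"
  shows "Vtx k = cycle_label q (nat (k - q))"
  using assms by (cases "nat (k - q)") auto

lemma deg_cycle:
  assumes "q < k" "k \<le> q + int n"
  shows "deg (cycle_graph (Suc n) q) (Vtx k) = 2"
  using assms by (simp add: cycle_label_nat deg_cycle_label)

lemma wt_cycle:
  assumes "q < j" "j \<le> q + int n" "q < k" "k \<le> q + int n"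
  shows "wt (cycle_graph (Suc n) q) (Vtx j) (Vtx k) = of_bool (j = k + 1 \<or> j = k - 1)"
  using assms by (auto simp: cycle_label_nat wt_cycle_label)

lemma Vtx_in_nonsink_cycle:
  "Vtx k \<in> nonsink (cycle_graph (Suc n) q) \<longleftrightarrow> q < k \<and> k \<le> q + int n"
  by (auto simp: nonsink_cycle_graph)

lemma sum_nonsink_cycle:
  "(\<Sum>v\<in>nonsink (cycle_graph (Suc n) q). g v) = (\<Sum>k = q + 1..q + int n. g (Vtx k))"
  by (simp add: nonsink_cycle_graph sum.reindex inj_on_def)

text \<open>The labels \<open>q\<close> and \<open>q + n + 1\<close> both stand for the sink;
  \<open>f\<close> vanishes there, so one formula also covers the end vertices.\<close>

lemma laplacian_cycle:
  assumes f: "\<And>v. v \<notin> nonsink (cycle_graph (Suc n) q) \<Longrightarrow> f v = 0"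
    and k: "q < k" "k \<le> q + int n"
  shows "laplacian (cycle_graph (Suc n) q) f (Vtx k)
    = 2 * int (f (Vtx k)) - int (f (Vtx (k - 1))) - int (f (Vtx (k + 1)))"
proof -
  have "(\<Sum>u\<in>nonsink (cycle_graph (Suc n) q). int (wt (cycle_graph (Suc n) q) u (Vtx k) * f u))
      = (\<Sum>j = q + 1..q + int n.
          (if j = k - 1 then int (f (Vtx (k - 1))) else 0)
          + (if j = k + 1 then int (f (Vtx (k + 1))) else 0))"
    unfolding sum_nonsink_cycle
    by (rule sum.cong) (use k in \<open>auto simp: wt_cycle\<close>)
  also have "\<dots> = int (f (Vtx (k - 1))) + int (f (Vtx (k + 1)))"
    using f[of "Vtx (k - 1)"] f[of "Vtx (k + 1)"] k
    by (auto simp: sum.distrib Vtx_in_nonsink_cycle)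
  finally show ?thesis using k by (simp add: laplacian_def deg_cycle)
qed

lemma stable_cycle_iff:
  "stable (cycle_graph (Suc n) q) c \<longleftrightarrow> (\<forall>k. q < k \<and> k \<le> q + int n \<longrightarrow> c (Vtx k) \<le> 1)"
proof -
  have "stable (cycle_graph (Suc n) q) c
      \<longleftrightarrow> (\<forall>k\<in>{q + 1..q + int n}. c (Vtx k) < deg (cycle_graph (Suc n) q) (Vtx k))"
    unfolding stable_def unstable_def nonsink_cycle_graph by (auto simp: not_le)
  also have "\<dots> \<longleftrightarrow> (\<forall>k\<in>{q + 1..q + int n}. c (Vtx k) < 2)"
    by (intro ball_cong refl) (simp add: deg_cycle)
  finally show ?thesis by (auto simp: numeral_2_eq_2 less_Suc_eq_le)
qed

text \<open>The quadratic vector below has constant Laplacian \<open>2 * K\<close>.\<close>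

lemma cycle_stabilizes:
  assumes "1 \<le> n"
  obtains vs c' where "toppling_seq (cycle_graph (Suc n) q) c vs c'"
    "stable (cycle_graph (Suc n) q) c'"
proof -
  let ?G = "cycle_graph (Suc n) q"
  \<comment> \<open>\<open>K\<close> dominates every entry of \<open>c\<close> at a non-sink vertex,
    so subtracting \<open>2 * K\<close> makes it nonpositive. The parabola \<open>p\<close> vanishes
    at both sink positions and is nonpositive beyond them, where \<open>nat\<close> truncates it to
    \<open>0\<close>.\<close>
  define K where "K = int (\<Sum>v\<in>nonsink ?G. c v)"
  define p where "p k = K * (k - q) * (q + int n + 1 - k)" for k
  define f where "f v = (case v of Sink \<Rightarrow> 0 | Vtx k \<Rightarrow> nat (p k))" for v
  have G: "sandpile_graph ?G" using assms by (intro sandpile_graph_cycle_graph) simp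
  have K: "int (c v) \<le> K" if "v \<in> nonsink ?G" for v
    unfolding K_def of_nat_le_iff using that finite_nonsink[OF G] by (intro member_le_sum) simp_all
  have K0: "0 \<le> K" by (simp add: K_def sum_nonneg)
  have f_out: "f v = 0" if "v \<notin> nonsink ?G" for v
  proof (cases v)
    case (Vtx k)
    then have "k \<le> q \<or> q + int n + 1 \<le> k" using that by (auto simp: Vtx_in_nonsink_cycle)
    then have "(k - q) * (q + int n + 1 - k) \<le> 0" by (auto simp: mult_le_0_iff)
    then have "p k \<le> 0" using K0 by (simp add: p_def mult.assoc mult_nonneg_nonpos)
    then show ?thesis by (simp add: f_def Vtx)
  qed (simp add: f_def)
  have f_in: "int (f (Vtx k)) = p k" if "q \<le> k" "k \<le> q + int n + 1" for k
    using that K0 by (simp add: f_def p_def)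
  have "bounds_topplings ?G c f"
    unfolding bounds_topplings_def
  proof
    fix v assume v: "v \<in> nonsink ?G"
    then obtain k where k: "v = Vtx k" "q < k" "k \<le> q + int n" by (auto simp: nonsink_cycle_graph)
    then have "laplacian ?G f v = 2 * p k - p (k - 1) - p (k + 1)"
      using f_out by (simp add: laplacian_cycle f_in)
    also have "\<dots> = 2 * K" by (simp add: p_def algebra_simps)
    finally show "int (c v) - laplacian ?G f v < int (deg ?G v)"
      using K[OF v] K0 k by (simp add: deg_cycle)
  qed
  with G show thesis using that by (blast elim: bounds_topplings_imp_stabilizes)
qed


section \<open>Avalanches on an interval of ones\<close>

text \<open>Away from \<open>z\<close>, \<open>h\<close> is at most the mean of its neighbours, so a
  maximum spreads towards the boundary, where \<open>h\<close> is \<open>0\<close>. At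
  \<open>z\<close> the two drops from the maximum are nonnegative integers with sum at most 1, so
  one is zero and the maximum passes to a neighbour.\<close>

lemma discrete_maximum_principle:
  fixes h :: "int \<Rightarrow> int"
  assumes z: "a < z" "z < b" and boundary: "h a = 0" "h b = 0"
    and kink: "\<And>k. a < k \<Longrightarrow> k < b \<Longrightarrow> 2 * h k - h (k - 1) - h (k + 1) \<le> of_bool (k = z)"
    and k: "a \<le> k" "k \<le> b"
  shows "h k \<le> 0"
proof -
  define M where "M = Max (h ` {a..b})"
  have le: "h j \<le> M" if "a \<le> j" "j \<le> b" for j
    unfolding M_def using that by (intro Max_ge) auto
  have "M \<in> h ` {a..b}" unfolding M_def using z by (intro Max_in) auto
  then obtain m where m: "a \<le> m" "m \<le> b" "h m = M" by auto
  have nbrs: "h (j - 1) = M \<and> h (j + 1) = M" if "a < j" "j < b" "j \<noteq> z" "h j = M" for j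
    using kink[of j] le[of "j - 1"] le[of "j + 1"] that by simp
  have right: "M = 0" if "z < j" "j \<le> b" "h j = M" for j
  proof -
    have "z < i \<longrightarrow> h i = M \<longrightarrow> M = 0" if "i \<le> b" for i
      using that
    proof (induction rule: int_le_induct)
      case base
      show ?case using boundary by simp
    next
      case (step i)
      show ?case using nbrs[of "i - 1"] step z by auto
    qed
    then show ?thesis using that by blast
  qed
  have left: "M = 0" if "a \<le> j" "j < z" "h j = M" for j
  proof -
    have "i < z \<longrightarrow> h i = M \<longrightarrow> M = 0" if "a \<le> i" for i
      using that
    proof (induction rule: int_ge_induct)
      case base
      show ?case using boundary by simp
    next
      case (step i)
      show ?case using nbrs[of "i + 1"] step z by auto
    qed
    then show ?thesis using that by blast
  qed
  have "M = 0"
  proof (cases m z rule: linorder_cases)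
    case equal
    then have "h (z - 1) = M \<or> h (z + 1) = M"
      using kink[of z] le[of "z - 1"] le[of "z + 1"] m z by auto
    then show ?thesis using left[of "z - 1"] right[of "z + 1"] z by auto
  qed (use left right m in auto)
  then show ?thesis using le k by metis
qed

text \<open>For \<open>i\<close> between \<open>a\<close> and \<open>b\<close>, a trapezoid with
  slopes 1 and -1 and a plateau between \<open>i\<close> and its mirror image
  \<open>a + b - i\<close>; \<open>nat\<close> cuts it off outside the interval.\<close>

definition avalanche_vector :: "int \<Rightarrow> int \<Rightarrow> int \<Rightarrow> int \<Rightarrow> nat" where
  "avalanche_vector a b i k = nat (min (min (i - a) (b - i)) (min (k - a) (b - k)))"

lemma avalanche_vector_eq_0: "k \<le> a \<or> b \<le> k \<Longrightarrow> avalanche_vector a b i k = 0"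
  by (auto simp: avalanche_vector_def)

text \<open>A piecewise linear function bends only at its corners. The two upper corners merge into
  one of weight 2 when \<open>i\<close> is the midpoint.\<close>

lemma avalanche_vector_second_difference:
  assumes "a < i" "i < b"
  shows "2 * int (avalanche_vector a b i k) - int (avalanche_vector a b i (k - 1))
      - int (avalanche_vector a b i (k + 1))
    = of_bool (k = i) + of_bool (k = a + b - i) - of_bool (k = a) - of_bool (k = b)"
  using assms unfolding avalanche_vector_def of_bool_def min_def
  by (smt (verit) nat_0_le nat_eq_iff2 int_nat_eq)

text \<open>The ends \<open>a\<close> and \<open>b\<close> are empty vertices or sink positions. The
  trapezoid is a bound, and its excess \<open>h\<close> over the true counts vanishes by the maximum
  principle.\<close>

lemma avalanche_on_interval:
  fixes n :: nat and q :: int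
  defines "G \<equiv> cycle_graph (Suc n) q"
  assumes c: "c \<in> sandpiles G" "stable G c"
    and i: "a < i" "i < b"
    and interval: "\<And>k. a < k \<Longrightarrow> k < b \<Longrightarrow> c (Vtx k) = 1" "c (Vtx a) = 0" "c (Vtx b) = 0"
  obtains vs c' where "toppling_seq G (\<lambda>w. c w + grain (Vtx i) w) vs c'" "stable G c'"
    "\<And>k. count_list vs (Vtx k) = avalanche_vector a b i k"
    "\<And>k. q < k \<Longrightarrow> k \<le> q + int n \<Longrightarrow> int (c' (Vtx k))
       = int (c (Vtx k)) + of_bool (k = a) + of_bool (k = b) - of_bool (k = a + b - i)"
proof -
  define d where "d = (\<lambda>w. c w + grain (Vtx i) w)"
  define f where "f v = (case v of Sink \<Rightarrow> 0 | Vtx k \<Rightarrow> avalanche_vector a b i k)" for v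
  \<comment> \<open>What firing the trapezoid leaves: the added grain cancels against the corner at
    \<open>i\<close>, each end gains a grain, and the mirror image of \<open>i\<close> loses
    one.\<close>
  define e where
    "e k = int (c (Vtx k)) + of_bool (k = a) + of_bool (k = b) - of_bool (k = a + b - i)" for k
  have in_range: "q < k \<and> k \<le> q + int n" if "a < k" "k < b" for k
    using that c(1) interval(1)[of k] Vtx_in_nonsink_cycle[of k n q]
    by (fastforce simp: sandpiles_def G_def)
  have n: "1 \<le> n" using in_range[of i] i by linarith
  then have G: "sandpile_graph G" unfolding G_def by (intro sandpile_graph_cycle_graph) simp
  have f_out: "f v = 0" if "v \<notin> nonsink G" for v
    using that in_range avalanche_vector_eq_0
    by (cases v) (fastforce simp: f_def G_def Vtx_in_nonsink_cycle not_less)+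
  have lap_f: "int (d (Vtx k)) - laplacian G f (Vtx k) = e k" if "q < k" "k \<le> q + int n" for k
    using laplacian_cycle[of n q f k] f_out that avalanche_vector_second_difference[OF i, of k]
    by (simp add: G_def f_def d_def e_def grain_def)
  have e_le: "e k \<le> 1" if "q < k" "k \<le> q + int n" for k
    using c(2) that interval i by (auto simp: stable_cycle_iff G_def e_def)
  have "bounds_topplings G d f"
    unfolding bounds_topplings_def
  proof
    fix v assume "v \<in> nonsink G"
    then obtain k where k: "v = Vtx k" "q < k" "k \<le> q + int n"
      by (auto simp: G_def nonsink_cycle_graph)
    then show "int (d v) - laplacian G f v < int (deg G v)"
      using lap_f[of k] e_le[of k] by (simp add: G_def deg_cycle)
  qed
  with G obtain vs c' where vs: "toppling_seq G d vs c'" "stable G c'"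
    and le: "\<And>v. count_list vs v \<le> f v"
    by (metis bounds_topplings_imp_stabilizes count_list_le_bound)
  define h where "h k = int (f (Vtx k)) - int (count_list vs (Vtx k))" for k
  have count_out: "count_list vs v = 0" if "v \<notin> nonsink G" for v
    using toppling_seq_subset_nonsink[OF vs(1)] that by (auto simp: count_list_0_iff)
  have c': "int (c' (Vtx k)) = e k + (2 * h k - h (k - 1) - h (k + 1))"
    if "q < k" "k \<le> q + int n" for k
    using lap_f[of k] toppling_seq_eq_laplacian[OF G vs(1), of "Vtx k"] that
      laplacian_cycle[of n q f k] laplacian_cycle[of n q "count_list vs" k] f_out count_out
    by (simp add: G_def h_def Vtx_in_nonsink_cycle)
  have f_ends: "f (Vtx k) = 0" if "k \<le> a \<or> b \<le> k" for k
    using that by (simp add: f_def avalanche_vector_eq_0)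
  have h_out: "h k = 0" if "k \<le> a \<or> b \<le> k" for k
    using le[of "Vtx k"] f_ends[OF that] by (simp add: h_def)
  \<comment> \<open>Inside the interval \<open>e\<close> is 1, except 0 at the mirror image, so
    stability of \<open>c'\<close> caps the Laplacian of \<open>h\<close>.\<close>
  have kink: "2 * h k - h (k - 1) - h (k + 1) \<le> of_bool (k = a + b - i)"
    if k: "a < k" "k < b" for k
  proof -
    have "int (c' (Vtx k)) \<le> 1"
      using vs(2) in_range[OF k] by (auto simp: G_def stable_cycle_iff)
    then show ?thesis
      using c'[of k] in_range[OF k] k interval(1)[OF k] by (simp add: e_def split: if_splits)
  qed
  have h0: "h k = 0" for k
  proof (cases "a \<le> k \<and> k \<le> b")
    case True
    then have "h k \<le> 0"
      using discrete_maximum_principle[of a "a + b - i" b h k] i h_out kink by simp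
    moreover have "0 \<le> h k" using le[of "Vtx k"] by (simp add: h_def)
    ultimately show ?thesis by simp
  qed (use h_out in auto)
  show thesis
  proof (rule that)
    show "toppling_seq G (\<lambda>w. c w + grain (Vtx i) w) vs c'" using vs(1) by (simp add: d_def)
    show "count_list vs (Vtx k) = avalanche_vector a b i k" for k
      using h0[of k] by (simp add: h_def f_def)
  qed (use vs(2) c' h0 in \<open>auto simp: e_def\<close>)
qed

lemma avalanche_monomial_interval:
  fixes n :: nat and q :: int
  defines "G \<equiv> cycle_graph (Suc n) q"
  assumes c: "c \<in> sandpiles G" "stable G c"
    and i: "a < i" "i < b"
    and interval: "\<And>k. a < k \<Longrightarrow> k < b \<Longrightarrow> c (Vtx k) = 1" "c (Vtx a) = 0" "c (Vtx b) = 0"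
  shows "avalanche_monomial G c (Vtx i)
    = (\<Prod>k = a + 1..b - 1. Var (Vtx k) ^ avalanche_vector a b i k)"
proof -
  have in_range: "q < k \<and> k \<le> q + int n" if "a < k" "k < b" for k
    using that c(1) interval(1)[of k] Vtx_in_nonsink_cycle[of k n q]
    by (fastforce simp: sandpiles_def G_def)
  have "1 \<le> n" using in_range[of i] i by linarith
  then have G: "sandpile_graph G" unfolding G_def by (intro sandpile_graph_cycle_graph) simp
  obtain vs c' where vs: "toppling_seq G (\<lambda>w. c w + grain (Vtx i) w) vs c'" "stable G c'"
    "\<And>k. count_list vs (Vtx k) = avalanche_vector a b i k"
    using avalanche_on_interval[OF c[unfolded G_def] i interval] unfolding G_def by metis
  have "avalanche_monomial G c (Vtx i)
      = (\<Prod>k = q + 1..q + int n. Var (Vtx k) ^ avalanche_vector a b i k)"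
    unfolding avalanche_monomial_def toppling_vector_eqI[OF G vs(1,2)]
    by (simp add: G_def nonsink_cycle_graph prod.reindex inj_on_def vs(3))
  also have "\<dots> = (\<Prod>k = a + 1..b - 1. Var (Vtx k) ^ avalanche_vector a b i k)"
  proof (rule prod.mono_neutral_right)
    show "{a + 1..b - 1} \<subseteq> {q + 1..q + int n}"
      using in_range[of "a + 1"] in_range[of "b - 1"] by auto
  qed (auto simp: avalanche_vector_eq_0)
  finally show ?thesis .
qed


section \<open>Recurrent sandpiles of the cycle\<close>

text \<open>\<open>Vtx q\<close> is not a vertex of the cycle, so \<open>p = q\<close> encodes the
  all-ones sandpile and one family covers every recurrent sandpile.\<close>

definition ones_except :: "nat \<Rightarrow> int \<Rightarrow> int \<Rightarrow> cycle_vertex \<Rightarrow> nat" where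
  "ones_except n q p v = (if v \<in> nonsink (cycle_graph (Suc n) q) - {Vtx p} then 1 else 0)"

lemma ones_except_sandpile: "ones_except n q p \<in> sandpiles (cycle_graph (Suc n) q)"
  by (simp add: ones_except_def sandpiles_def)

lemma ones_except_stable: "stable (cycle_graph (Suc n) q) (ones_except n q p)"
  by (simp add: ones_except_def stable_cycle_iff)

lemma ones_except_Vtx:
  "ones_except n q p (Vtx k) = of_bool (q < k \<and> k \<le> q + int n \<and> k \<noteq> p)"
  by (auto simp: ones_except_def Vtx_in_nonsink_cycle)

lemma all_ones_eq_ones_except: "all_ones (cycle_graph (Suc n) q) = ones_except n q q"
  by (auto simp: all_ones_def ones_except_def Vtx_in_nonsink_cycle)

text \<open>Two empty vertices make the path between them forbidden: an end has one neighbour in the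
  path but no grain, an inner vertex has two neighbours but at most one grain.\<close>

lemma recurrent_imp_at_most_one_empty:
  assumes n: "1 \<le> n" and c: "c \<in> recurrents (cycle_graph (Suc n) q)"
    and p: "q < p" "p < r" "r \<le> q + int n"
  shows "c (Vtx p) \<noteq> 0 \<or> c (Vtx r) \<noteq> 0"
proof (rule ccontr)
  assume "\<not> ?thesis"
  then have empty: "c (Vtx p) = 0" "c (Vtx r) = 0" by auto
  let ?G = "cycle_graph (Suc n) q"
  have G: "sandpile_graph ?G" using n by (intro sandpile_graph_cycle_graph) simp
  have st: "stable ?G c" using c by (simp add: recurrents_def)
  have "\<exists>v\<in>Vtx ` {p..r}. (\<Sum>u\<in>Vtx ` {p..r}. wt ?G u v) \<le> c v"
  proof (rule recurrent_burning[OF G c])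
    show "\<exists>vs a'. toppling_seq ?G a vs a' \<and> stable ?G a'" for a
      using cycle_stabilizes[OF n] by metis
  qed (use p in \<open>auto simp: Vtx_in_nonsink_cycle\<close>)
  then obtain k where k: "p \<le> k" "k \<le> r" and le: "(\<Sum>u\<in>Vtx ` {p..r}. wt ?G u (Vtx k)) \<le> c (Vtx k)"
    by auto
  have "(\<Sum>u\<in>Vtx ` {p..r}. wt ?G u (Vtx k)) = (\<Sum>j = p..r. wt ?G (Vtx j) (Vtx k))"
    by (simp add: sum.reindex inj_on_def)
  also have "\<dots> = (\<Sum>j = p..r. (if j = k - 1 then 1 else 0) + (if j = k + 1 then 1 else 0))"
    by (rule sum.cong) (use k p in \<open>auto simp: wt_cycle\<close>)
  also have "\<dots> = of_bool (p < k) + of_bool (k < r)"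
    using k by (auto simp: sum.distrib)
  finally have "of_bool (p < k) + of_bool (k < r) \<le> c (Vtx k)" using le by simp
  moreover have "c (Vtx k) \<le> 1" using st k p by (auto simp: stable_cycle_iff)
  ultimately show False using empty p k by (auto simp: of_bool_def split: if_splits)
qed

text \<open>Stabilize \<open>a\<close>, top the result up to all ones, then add \<open>g\<close> to
  reach the target. The extra grains can be added in advance, since legal topplings stay legal with
  more sand.\<close>

lemma ones_except_recurrent:
  assumes n: "1 \<le> n" and p: "q \<le> p" "p \<le> q + int n"
  shows "ones_except n q p \<in> recurrents (cycle_graph (Suc n) q)"
proof -
  let ?G = "cycle_graph (Suc n) q"
  let ?one = "ones_except n q q"
  have G: "sandpile_graph ?G" using n by (intro sandpile_graph_cycle_graph) simp
  \<comment> \<open>The grain at the mirror image of \<open>p\<close> empties \<open>p\<close>; for \<open>p = q\<close> no grain is needed.\<close>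
  obtain g ws where g: "g \<in> sandpiles ?G"
    and ws: "toppling_seq ?G (\<lambda>w. ?one w + g w) ws (ones_except n q p)"
  proof (cases "p = q")
    case True
    show ?thesis
    proof (rule that)
      show "(\<lambda>_. 0) \<in> sandpiles ?G" by (simp add: sandpiles_def)
      show "toppling_seq ?G (\<lambda>w. ?one w + 0) [] (ones_except n q p)"
        using True by (simp add: toppling_seq_Nil)
    qed
  next
    case False
    define i where "i = 2 * q + int n + 1 - p"
    have i: "q < i" "i < q + int n + 1" using p False by (auto simp: i_def)
    obtain ws c' where ws: "toppling_seq ?G (\<lambda>w. ?one w + grain (Vtx i) w) ws c'"
      "\<And>k. q < k \<Longrightarrow> k \<le> q + int n \<Longrightarrow> int (c' (Vtx k)) = int (?one (Vtx k))
         + of_bool (k = q) + of_bool (k = q + int n + 1) - of_bool (k = q + (q + int n + 1) - i)"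
      by (rule avalanche_on_interval[OF ones_except_sandpile ones_except_stable i, of n q q])
         (auto simp: ones_except_Vtx)
    have gi: "grain (Vtx i) \<in> sandpiles ?G"
      using i by (auto simp: sandpiles_def grain_def Vtx_in_nonsink_cycle)
    have "c' = ones_except n q p"
    proof
      fix v
      show "c' v = ones_except n q p v"
      proof (cases "v \<in> nonsink ?G")
        case True
        then obtain k where k: "v = Vtx k" "q < k" "k \<le> q + int n"
          by (auto simp: nonsink_cycle_graph)
        then show ?thesis
          using ws(2)[of k] by (cases "k = p") (simp_all add: i_def ones_except_Vtx)
      next
        case out: False
        then show ?thesis
          using toppling_seq_outside[OF ws(1) out] gi
          by (simp add: ones_except_def sandpiles_def)
      qed
    qed
    with ws(1) gi show ?thesis using that by blast
  qed
  have "\<exists>b\<in>sandpiles ?G. stable_sum ?G a b = ones_except n q p" if a: "a \<in> sandpiles ?G" for a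
  proof -
    obtain vs a' where vs: "toppling_seq ?G a vs a'" "stable ?G a'"
      using cycle_stabilizes[OF n] by blast
    define b where "b = (\<lambda>v. (?one v - a' v) + g v)"
    have a': "a' v \<le> ?one v" for v
    proof (cases "v \<in> nonsink ?G")
      case True
      then show ?thesis
        using vs(2) by (auto simp: nonsink_cycle_graph stable_cycle_iff ones_except_Vtx)
    next
      case False
      then show ?thesis using toppling_seq_outside[OF vs(1)] a by (simp add: sandpiles_def)
    qed
    have "toppling_seq ?G (\<lambda>v. a v + b v) vs (\<lambda>v. a' v + b v)"
      by (rule toppling_seq_add[OF vs(1)])
    also have "(\<lambda>v. a' v + b v) = (\<lambda>v. ?one v + g v)"
      using a' by (simp add: b_def trans_le_add1)
    finally have "toppling_seq ?G (\<lambda>v. a v + b v) (vs @ ws) (ones_except n q p)"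
      using ws by (rule toppling_seq_append)
    then have "stable_sum ?G a b = ones_except n q p"
      unfolding stable_sum_def by (rule stabilization_eqI[OF G _ ones_except_stable])
    moreover have "b \<in> sandpiles ?G"
      using g by (simp add: b_def sandpiles_def ones_except_def)
    ultimately show ?thesis by blast
  qed
  then show ?thesis
    by (simp add: recurrents_def ones_except_sandpile ones_except_stable)
qed

lemma recurrents_cycle:
  assumes "1 \<le> n"
  shows "recurrents (cycle_graph (Suc n) q) = ones_except n q ` {q..q + int n}"
proof (intro equalityI subsetI)
  fix c assume c: "c \<in> recurrents (cycle_graph (Suc n) q)"
  then have stable: "c (Vtx k) \<le> 1" if "q < k" "k \<le> q + int n" for k
    using that by (auto simp: recurrents_def stable_cycle_iff)
  have c_out: "c v = 0" if "v \<notin> nonsink (cycle_graph (Suc n) q)" for v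
    using c that by (simp add: recurrents_def sandpiles_def)
  obtain p where p: "q \<le> p" "p \<le> q + int n"
    and c_p: "\<And>k. q < k \<Longrightarrow> k \<le> q + int n \<Longrightarrow> c (Vtx k) = 0 \<longleftrightarrow> k = p"
  proof (cases "\<exists>p. q < p \<and> p \<le> q + int n \<and> c (Vtx p) = 0")
    case True
    then obtain p where p: "q < p" "p \<le> q + int n" "c (Vtx p) = 0" by blast
    have unique: "k = p" if "q < k" "k \<le> q + int n" "c (Vtx k) = 0" for k
      using recurrent_imp_at_most_one_empty[OF assms c, of k p]
        recurrent_imp_at_most_one_empty[OF assms c, of p k] that p
      by (cases k p rule: linorder_cases) simp_all
    show ?thesis
    proof (rule that)
      show "c (Vtx k) = 0 \<longleftrightarrow> k = p" if "q < k" "k \<le> q + int n" for k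
        using unique that p(3) by blast
    qed (use p in simp_all)
  next
    case False
    \<comment> \<open>No vertex is empty, so the dummy label \<open>q\<close> serves as
      \<open>p\<close>.\<close>
    then show ?thesis by (intro that[of q]) auto
  qed
  have "c = ones_except n q p"
  proof
    fix v
    show "c v = ones_except n q p v"
    proof (cases "v \<in> nonsink (cycle_graph (Suc n) q)")
      case True
      then obtain k where k: "v = Vtx k" "q < k" "k \<le> q + int n"
        by (auto simp: nonsink_cycle_graph)
      then show ?thesis using c_p[of k] stable[of k] by (auto simp: ones_except_Vtx)
    qed (simp add: c_out ones_except_def)
  qed
  with p show "c \<in> ones_except n q ` {q..q + int n}" by auto
qed (use ones_except_recurrent[OF assms] in auto)

lemma inj_on_ones_except: "inj_on (ones_except n q) {q..q + int n}"
proof (rule inj_onI)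
  fix p r assume p: "p \<in> {q..q + int n}" "r \<in> {q..q + int n}"
    and eq: "ones_except n q p = ones_except n q r"
  show "p = r"
  proof (rule ccontr)
    assume "p \<noteq> r"
    then show False
      using fun_cong[OF eq, of "Vtx p"] fun_cong[OF eq, of "Vtx r"] p
      by (simp add: ones_except_Vtx)
  qed
qed


section \<open>The avalanche polynomial\<close>

text \<open>With no empty vertex the interval runs from the sink at \<open>q\<close> round to the
  sink at \<open>q + n + 1\<close>.\<close>

lemma avalanche_monomial_all_ones:
  assumes "q < i" "i \<le> q + int n"
  shows "avalanche_monomial (cycle_graph (Suc n) q) (all_ones (cycle_graph (Suc n) q)) (Vtx i)
    = (\<Prod>k = q + 1..q + int n. Var (Vtx k) ^ avalanche_vector q (q + int n + 1) i k)"
  using avalanche_monomial_interval[OF ones_except_sandpile ones_except_stable,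
      of q i "q + int n + 1" n q q] assms
  by (simp add: all_ones_eq_ones_except ones_except_Vtx)

text \<open>The empty \<open>p\<close> absorbs what reaches it without toppling, like the sink of a
  smaller cycle; both sides have exponents \<open>avalanche_vector 0 p i\<close>.\<close>

lemma avalanche_monomial_below_empty:
  assumes "1 \<le> i" "i < int p" "p \<le> n"
  shows "avalanche_monomial (cycle_graph (Suc n) 0) (ones_except n 0 (int p)) (Vtx i)
    = avalanche_monomial (cycle_graph p 0) (all_ones (cycle_graph p 0)) (Vtx i)"
proof -
  \<comment> \<open>The cycle on \<open>p\<close> vertices has \<open>m = p - 1\<close> non-sink
    vertices, so its right-hand sink position is \<open>p\<close>.\<close>
  obtain m where m: "p = Suc m" using assms by (cases p) auto
  show ?thesis
    using avalanche_monomial_interval[OF ones_except_sandpile ones_except_stable,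
        of 0 i "int p" n 0 "int p"] avalanche_monomial_all_ones[of 0 i m] assms
    by (simp add: ones_except_Vtx m add.commute)
qed

text \<open>Here \<open>p\<close> acts as the left sink: shifting the labels by \<open>p\<close>
  puts the sink positions of the smaller cycle at \<open>p\<close> and \<open>n + 1\<close>.\<close>

lemma avalanche_monomial_above_empty:
  assumes "1 \<le> p" "int p < i" "i \<le> int n"
  shows "avalanche_monomial (cycle_graph (Suc n) 0) (ones_except n 0 (int p)) (Vtx i)
    = avalanche_monomial (cycle_graph (n - p + 1) (int p))
        (all_ones (cycle_graph (n - p + 1) (int p))) (Vtx i)"
  using avalanche_monomial_interval[OF ones_except_sandpile ones_except_stable,
      of "int p" i "int n + 1" n 0 "int p"] avalanche_monomial_all_ones[of "int p" i "n - p"] assms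
  by (simp add: ones_except_Vtx of_nat_diff)

text \<open>The grain fills the hole, giving the stable all-ones sandpile without any
  toppling.\<close>

lemma avalanche_monomial_at_empty:
  assumes "1 \<le> p" "p \<le> n"
  shows "avalanche_monomial (cycle_graph (Suc n) 0) (ones_except n 0 (int p)) (Vtx (int p)) = 1"
proof -
  let ?G = "cycle_graph (Suc n) 0"
  let ?c = "\<lambda>w. ones_except n 0 (int p) w + grain (Vtx (int p)) w"
  have "sandpile_graph ?G" using assms by (intro sandpile_graph_cycle_graph) simp
  moreover have "stable ?G ?c"
    by (auto simp: stable_cycle_iff ones_except_Vtx grain_def)
  ultimately have "toppling_vector ?G ?c = count_list []"
    by (rule toppling_vector_eqI[OF _ toppling_seq_Nil])
  then show ?thesis by (simp add: avalanche_monomial_def)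
qed

lemma sum_avalanche_monomial_one_empty:
  assumes "1 \<le> p" "p \<le> n"
  shows "(\<Sum>v\<in>nonsink (cycle_graph (Suc n) 0).
      avalanche_monomial (cycle_graph (Suc n) 0) (ones_except n 0 (int p)) v)
    = (\<Sum>i = 1..int p - 1. avalanche_monomial (cycle_graph p 0) (all_ones (cycle_graph p 0)) (Vtx i))
    + (\<Sum>i = int p + 1..int n. avalanche_monomial (cycle_graph (n - p + 1) (int p))
        (all_ones (cycle_graph (n - p + 1) (int p))) (Vtx i))
    + 1"
proof -
  let ?\<mu> = "\<lambda>i. avalanche_monomial (cycle_graph (Suc n) 0) (ones_except n 0 (int p)) (Vtx i)"
  have split: "{1..int n} = insert (int p) ({1..int p - 1} \<union> {int p + 1..int n})"
    using assms by auto
  have "(\<Sum>i = 1..int n. ?\<mu> i)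
      = ?\<mu> (int p) + ((\<Sum>i = 1..int p - 1. ?\<mu> i) + (\<Sum>i = int p + 1..int n. ?\<mu> i))"
    unfolding split by (subst sum.insert, simp, simp, subst sum.union_disjoint) auto
  then show ?thesis
    unfolding sum_nonsink_cycle using assms
    by (simp add: avalanche_monomial_at_empty avalanche_monomial_below_empty
        avalanche_monomial_above_empty)
qed

lemma avalanche_polynomial_cycle:
  assumes n: "1 \<le> n"
  shows "avalanche_polynomial (cycle_graph (n + 1) 0) =
      (\<Sum>i = 1..int n.
          avalanche_monomial (cycle_graph (n + 1) 0) (all_ones (cycle_graph (n + 1) 0)) (Vtx i))
    + (\<Sum>p = 2..n. \<Sum>i = 1..int p - 1.
          avalanche_monomial (cycle_graph p 0) (all_ones (cycle_graph p 0)) (Vtx i))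
    + (\<Sum>p = 1..n - 1. \<Sum>i = int p + 1..int n.
          avalanche_monomial (cycle_graph (n - p + 1) (int p))
            (all_ones (cycle_graph (n - p + 1) (int p))) (Vtx i))
    + of_nat n"
proof -
  let ?G = "cycle_graph (Suc n) 0"
  let ?S = "\<lambda>c. \<Sum>v\<in>nonsink ?G. avalanche_monomial ?G c v"
  let ?L = "\<lambda>p. \<Sum>i = 1..int p - 1.
    avalanche_monomial (cycle_graph p 0) (all_ones (cycle_graph p 0)) (Vtx i)"
  let ?R = "\<lambda>p. \<Sum>i = int p + 1..int n. avalanche_monomial (cycle_graph (n - p + 1) (int p))
    (all_ones (cycle_graph (n - p + 1) (int p))) (Vtx i)"
  have "int ` {0..n} = {0..int n}" by (simp add: image_int_atLeastAtMost)
  then have rec: "recurrents ?G = (\<lambda>p. ones_except n 0 (int p)) ` {0..n}"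
    using recurrents_cycle[OF n, of 0] by (simp add: image_image[symmetric, of _ int])
  have inj: "inj_on (\<lambda>p. ones_except n 0 (int p)) {0..n}"
    using comp_inj_on[OF inj_on_of_nat, of "ones_except n 0" "{0..n}"] inj_on_ones_except[of n 0]
    by (simp add: image_int_atLeastAtMost comp_def)
  have "avalanche_polynomial ?G = (\<Sum>p = 0..n. ?S (ones_except n 0 (int p)))"
    unfolding avalanche_polynomial_def rec by (simp add: sum.reindex[OF inj])
  also have "\<dots> = ?S (ones_except n 0 0) + (\<Sum>p = 1..n. ?S (ones_except n 0 (int p)))"
    by (simp add: sum.atLeast_Suc_atMost)
  \<comment> \<open>The summand 1 is the grain dropped on \<open>p\<close> itself; over all
    \<open>p\<close> these give the constant term \<open>n\<close>.\<close>
  also have "(\<Sum>p = 1..n. ?S (ones_except n 0 (int p))) = (\<Sum>p = 1..n. ?L p + ?R p + 1)"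
    by (rule sum.cong) (auto simp: sum_avalanche_monomial_one_empty simp del: Suc_diff_le)
  also have "\<dots> = (\<Sum>p = 1..n. ?L p) + (\<Sum>p = 1..n. ?R p) + of_nat n"
    by (simp add: sum.distrib)
  \<comment> \<open>No vertex lies below \<open>p = 1\<close>, and none above \<open>p = n\<close>,
    so these inner sums are empty and the ranges shrink.\<close>
  also have "(\<Sum>p = 1..n. ?L p) = (\<Sum>p = 2..n. ?L p)"
    by (rule sum.mono_neutral_right) (auto simp: not_le)
  also have "(\<Sum>p = 1..n. ?R p) = (\<Sum>p = 1..n - 1. ?R p)"
    by (rule sum.mono_neutral_right) auto
  finally show ?thesis
    by (simp add: sum_nonsink_cycle all_ones_eq_ones_except add.assoc)
qed

text \<open>Double counting: the exponent of \<open>Var (Vtx k)\<close> is the number of layers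
  \<open>j\<close> whose interval contains \<open>k\<close>. These form an initial segment, whose
  length is the trapezoid at \<open>k\<close>.\<close>

lemma avalanche_monomial_all_ones_wave_form:
  assumes i: "1 \<le> i" "i \<le> int q"
  shows "avalanche_monomial (cycle_graph (q + 1) 0) (all_ones (cycle_graph (q + 1) 0)) (Vtx i) =
    (\<Prod>j = 1..min i (int q - i + 1). \<Prod>k = j..int q - j + 1. Var (Vtx k))"
proof -
  let ?m = "min i (int q - i + 1)"
  have "(\<Prod>j = 1..?m. \<Prod>k = j..int q - j + 1. Var (Vtx k))
      = (\<Prod>j = 1..?m. \<Prod>k | k \<in> {1..int q} \<and> j \<le> k \<and> k \<le> int q - j + 1. Var (Vtx k))"
    by (intro prod.cong) auto
  also have "\<dots> = (\<Prod>k = 1..int q. \<Prod>j | j \<in> {1..?m} \<and> j \<le> k \<and> k \<le> int q - j + 1. Var (Vtx k))"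
    by (rule prod.swap_restrict) auto
  also have "\<dots> = (\<Prod>k = 1..int q. Var (Vtx k) ^ avalanche_vector 0 (int q + 1) i k)"
  proof (rule prod.cong[OF refl])
    fix k
    have "{j. j \<in> {1..?m} \<and> j \<le> k \<and> k \<le> int q - j + 1} = {1..min ?m (min k (int q + 1 - k))}"
      by auto
    then show "(\<Prod>j | j \<in> {1..?m} \<and> j \<le> k \<and> k \<le> int q - j + 1. Var (Vtx k))
        = Var (Vtx k) ^ avalanche_vector 0 (int q + 1) i k"
      by (simp add: avalanche_vector_def algebra_simps)
  qed
  finally show ?thesis
    using avalanche_monomial_all_ones[of 0 i q] i by simp
qed

theorem corollary29:
  fixes n :: nat
  assumes "1 \<le> n"
  shows "(avalanche_polynomial (cycle_graph (n + 1) 0) =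
      (\<Sum>i = 1..int n.
          avalanche_monomial (cycle_graph (n + 1) 0) (all_ones (cycle_graph (n + 1) 0)) (Vtx i))
    + (\<Sum>p = 2..n. \<Sum>i = 1..int p - 1.
          avalanche_monomial (cycle_graph p 0) (all_ones (cycle_graph p 0)) (Vtx i))
    + (\<Sum>p = 1..n - 1. \<Sum>i = int p + 1..int n.
          avalanche_monomial (cycle_graph (n - p + 1) (int p))
            (all_ones (cycle_graph (n - p + 1) (int p))) (Vtx i))
    + of_nat n) \<and>
    (\<forall>q::nat. \<forall>i::int. 1 \<le> q \<and> 1 \<le> i \<and> i \<le> int q \<longrightarrow>
      avalanche_monomial (cycle_graph (q + 1) 0) (all_ones (cycle_graph (q + 1) 0)) (Vtx i) =
      (\<Prod>j = 1..min i (int q - i + 1). \<Prod>k = j..int q - j + 1. Var (Vtx k)))"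
  using avalanche_polynomial_cycle[OF assms] avalanche_monomial_all_ones_wave_form by blast

end
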